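(* Let $n\ge 2$ be an integer and let $N$ be an integer with $N\ge \frac{25}{19}n+43$. Then $P_N^3\to(\mathcal{C}_{\le 8},P_n)$. Consequently $\hat{R}(\mathcal{C},P_n)\le \hat{R}(\mathcal{C}_{\le 8},P_n)\le \frac{75}{19}n+O(1)$.
   Context: $P_N^3$ is the graph on vertex set $\{1,\dots,N\}$ in which $i,j$ are adjacent iff $1\le|i-j|\le 3$. For a family of graphs $\mathcal{F}$ and a graph $H$, $G\to(\mathcal{F},H)$ means every red/blue coloring of $E(G)$ contains a red copy of some member of $\mathcal{F}$ or a blue copy of $H$. $\hat{R}(\mathcal{F},H)=\min\{|E(G)|: G\to(\mathcal{F},H)\}$. $P_n$ is the path on $n$ vertices, $\mathcal{C}$ the family of all cycles, $\mathcal{C}_{\le m}$ the family of all cycles of length at most $m$. *)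

theory Defs
  imports Complex_Main
begin

text \<open>A (simple) graph is given by its edge set: a set of 2-element vertex sets.
  Vertices not on edges play no role for the properties below.\<close>

definition simple_graph :: "'a set set \<Rightarrow> bool" where
  "simple_graph E \<longleftrightarrow> finite E \<and> (\<forall>e\<in>E. card e = 2)"

definition path_power3 :: "nat \<Rightarrow> nat set set" where
  "path_power3 N = {{i, j} | i j. i \<in> {1..N} \<and> j \<in> {1..N} \<and> i < j \<and> j - i \<le> 3}"

definition has_cycle_len :: "'a set set \<Rightarrow> nat \<Rightarrow> bool" where
  "has_cycle_len F k \<longleftrightarrow> 3 \<le> k \<and>
     (\<exists>vs. length vs = k \<and> distinct vs \<and>
        (\<forall>i<k. {vs ! i, vs ! ((i + 1) mod k)} \<in> F))"

definition has_path :: "'a set set \<Rightarrow> nat \<Rightarrow> bool" where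
  "has_path F n \<longleftrightarrow>
     (\<exists>vs. length vs = n \<and> distinct vs \<and> (\<forall>i. i + 1 < n \<longrightarrow> {vs ! i, vs ! (i + 1)} \<in> F))"

text \<open>A family of cycles is described by the set \<open>L\<close> of admissible lengths.
  \<open>G \<rightarrow> (\<C>_L, P_n)\<close>: for every red/blue colouring (red set \<open>R\<close>, blue = rest),
  there is a red cycle of admissible length or a blue \<open>P_n\<close>.\<close>
definition arrows_cyc_path :: "'a set set \<Rightarrow> nat set \<Rightarrow> nat \<Rightarrow> bool" where
  "arrows_cyc_path E L n \<longleftrightarrow>
     (\<forall>R. R \<subseteq> E \<longrightarrow> (\<exists>k\<in>L. has_cycle_len R k) \<or> has_path (E - R) n)"

definition all_cycles :: "nat set" where "all_cycles = {k. 3 \<le> k}"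
definition cycles_le :: "nat \<Rightarrow> nat set" where "cycles_le m = {k. 3 \<le> k \<and> k \<le> m}"

text \<open>Size Ramsey number: minimum number of edges of a (finite simple) graph arrowing.
  Every finite graph is isomorphic to one on natural-number vertices.\<close>
definition size_ramsey_cyc_path :: "nat set \<Rightarrow> nat \<Rightarrow> nat" where
  "size_ramsey_cyc_path L n =
     Inf {card E | E :: nat set set. simple_graph E \<and> arrows_cyc_path E L n}"

end

theory Submission
  imports Defs
begin

text \<open>Fix a colouring of the cube of a path without red cycles of length at most 6
  and scan the vertices from left to right. After vertex \<open>i\<close>, only two things matter: the
  red distances between the last three vertices, because a new vertex with red edges to two vertices
  at red distance at most 4 closes a short red cycle; and which long blue paths in \<open>{..i}\<close> end near
  \<open>i\<close>, where several candidate paths have to be kept because the best one may get stuck.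
  Measuring a path on \<open>l\<close> vertices by the excess of \<open>25 l\<close> over \<open>19 i\<close>, there is a finite list of such
  states that is closed under adding a vertex, whatever the colours of its three edges to the left.
  So some blue path has excess bounded below by a constant for every \<open>i\<close>.\<close>

section \<open>The scanning automaton\<close>

text \<open>The vertices \<open>i, i - 1, i - 2\<close> are denoted by their offsets 0, 1, 2 from the current vertex \<open>i\<close>.
  In a triple of type \<open>dists\<close>, the entries are upper bounds on the red distances between the offsets
  0 and 1, 0 and 2, 1 and 2; the value 1 means a red edge (and other values a blue one), values
  from 5 on carry no information. A \<open>config\<close> \<open>(e, F, w)\<close> stands for a blue path in \<open>{..i}\<close>
  that ends at offset \<open>e\<close>, avoids the offsets in \<open>F\<close> and has excess at least \<open>w\<close>. The type \<open>reds\<close>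
  tells which edges from \<open>i + 1\<close> to the offsets 0, 1, 2 are red.\<close>

type_synonym dists = "nat \<times> nat \<times> nat"
type_synonym config = "nat \<times> nat list \<times> int"
type_synonym reds = "bool \<times> bool \<times> bool"

fun closes_cycle :: "dists \<Rightarrow> reds \<Rightarrow> bool" where
  "closes_cycle (x, y, z) (r0, r1, r2) \<longleftrightarrow>
     r0 \<and> r1 \<and> x < 5 \<or> r0 \<and> r2 \<and> y < 5 \<or> r1 \<and> r2 \<and> z < 5"

text \<open>The first two entries route through a red edge at the new vertex and then along an old
  distance, capped at 5. The third concerns the old offsets 0 and 1, which may now be joined by a
  detour through the new vertex; the old offset 2 drops out of view.\<close>

definition next_dists :: "dists \<Rightarrow> reds \<Rightarrow> dists" where
  "next_dists = (\<lambda>(x, y, z) (r0, r1, r2).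
     (let u = min (if r0 then 1 else 5) (min (if r1 then x + 1 else 5) (if r2 then y + 1 else 5));
          v = min (if r1 then 1 else 5) (min (if r0 then x + 1 else 5) (if r2 then z + 1 else 5))
      in (u, v, min x (u + v))))"

text \<open>Larger bounds lose information, but the value 1 has to be preserved in both directions,
  since it also records which edges are blue.\<close>

fun weaker_dists :: "dists \<Rightarrow> dists \<Rightarrow> bool" where
  "weaker_dists (x, y, z) (x', y', z') \<longleftrightarrow>
     x \<le> x' \<and> y \<le> y' \<and> z \<le> z' \<and> (x = 1 \<longleftrightarrow> x' = 1) \<and> (y = 1 \<longleftrightarrow> y' = 1) \<and> (z = 1 \<longleftrightarrow> z' = 1)"

text \<open>Here and in \<open>extensions\<close>, the offsets are already those from the new vertex \<open>i + 1\<close>.\<close>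

definition blue_pair :: "dists \<Rightarrow> reds \<Rightarrow> nat \<Rightarrow> nat \<Rightarrow> bool" where
  "blue_pair = (\<lambda>(x, y, z) (r0, r1, r2) a b.
     (if a = 0 then (if b = 1 then \<not> r0 else if b = 2 then \<not> r1 else b = 3 \<and> \<not> r2)
      else if a = 1 then (if b = 0 then \<not> r0 else if b = 2 then x \<noteq> 1 else b = 3 \<and> y \<noteq> 1)
      else if a = 2 then (if b = 0 then \<not> r1 else if b = 1 then x \<noteq> 1 else b = 3 \<and> z \<noteq> 1)
      else a = 3 \<and> (if b = 0 then \<not> r2 else if b = 1 then y \<noteq> 1 else b = 2 \<and> z \<noteq> 1)))"

fun extensions :: "nat \<Rightarrow> (nat \<Rightarrow> nat \<Rightarrow> bool) \<Rightarrow> config \<Rightarrow> config list" where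
  "extensions 0 b c = [c]"
| "extensions (Suc n) b (e, F, w) =
     (e, F, w) # concat (map (\<lambda>f. extensions n b (f, removeAll f F, w + 25)) (filter (b e) F))"

fun shift :: "config \<Rightarrow> config" where
  "shift (e, F, w) = (Suc e, 0 # map Suc F, w - 19)"

text \<open>Every configuration in \<open>states\<close> ends at one of the offsets 0, 1, 2, so
  after \<open>shift\<close> at most three other offsets are free and depth 3 exhausts all
  extensions.\<close>

definition successors :: "dists \<Rightarrow> reds \<Rightarrow> config list \<Rightarrow> config list" where
  "successors t r cs = concat (map (\<lambda>c. extensions 3 (blue_pair t r) (shift c)) cs)"

fun dominates :: "config \<Rightarrow> config \<Rightarrow> bool" where
  "dominates (e, F, w) (e', F', w') \<longleftrightarrow> e = e' \<and> w' \<le> w \<and> set F' \<subseteq> set F"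

definition covers :: "config list \<Rightarrow> config list \<Rightarrow> bool" where
  "covers cs cs' \<longleftrightarrow> list_all (\<lambda>c'. list_ex (\<lambda>c. dominates c c') cs) cs'"

type_synonym state = "dists \<times> config list"

definition covered_in :: "state list \<Rightarrow> dists \<Rightarrow> config list \<Rightarrow> bool" where
  "covered_in S t cs \<longleftrightarrow>
     list_ex (covers cs) (map snd (filter (\<lambda>s. weaker_dists t (fst s)) S))"

definition all_reds :: "reds list" where
  "all_reds = List.product [False, True] (List.product [False, True] [False, True])"

fun step_closed :: "state list \<Rightarrow> state \<Rightarrow> bool" where
  "step_closed S (t, cs) \<longleftrightarrow>
     list_all (\<lambda>r. if closes_cycle t r then True else covered_in S (next_dists t r) (successors t r cs)) all_reds"

text \<open>A set of states closed under \<open>step_closed\<close>, found by a computer search: the weights are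
  potentials for the game in which an adversary colours the three edges from each new vertex, and
  each state was weakened as far as the potentials allow in order to keep the list short.\<close>

definition states :: "state list" where
  "states = [
  ((1,1,4), [(1,[0],-75),(2,[0],-50)]),
  ((1,1,4), [(1,[0],-63),(2,[0],-88)]),
  ((1,1,4), [(1,[],-70),(2,[0,1],-95)]),
  ((1,1,4), [(2,[0],-71),(2,[0,1],-96)]),
  ((1,1,4), [(0,[1],-88),(2,[0],-63),(2,[0,1],-113)]),
  ((1,1,5), [(0,[1],-76),(1,[0],-76),(2,[0],-51)]),
  ((1,1,5), [(0,[],-32),(1,[],-82)]),
  ((1,1,5), [(0,[],-52),(1,[],-77)]),
  ((1,1,5), [(0,[],-76),(1,[0],-51)]),
  ((1,1,5), [(0,[],-59),(1,[0],-84),(2,[0],-59)]),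
  ((1,1,5), [(0,[],-71),(1,[0],-71)]),
  ((1,1,5), [(0,[1],-53),(2,[0,1],-103)]),
  ((1,2,1), [(0,[],-76),(0,[1],-101),(1,[0],-76),(2,[],-51)]),
  ((1,2,1), [(2,[],-65),(2,[0,1],-90)]),
  ((1,3,1), [(1,[0],-88),(2,[],-63),(2,[0,1],-113)]),
  ((1,4,1), [(0,[1],-89),(1,[0],-64),(2,[1],-64)]),
  ((1,4,1), [(0,[1],-65),(1,[0],-90),(2,[0,1],-90)]),
  ((1,4,1), [(0,[],-57),(2,[0],-107),(2,[1],-82)]),
  ((1,4,1), [(0,[],-45),(2,[0,1],-95)]),
  ((1,4,1), [(1,[0],-119),(2,[],-44),(2,[0,1],-94)]),
  ((1,4,1), [(0,[],-52),(2,[],-77)]),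
  ((1,4,1), [(0,[],-59),(0,[1],-84),(1,[0],-84),(2,[],-59)]),
  ((1,4,1), [(0,[],-53),(1,[],-78),(2,[0,1],-103)]),
  ((1,4,1), [(0,[],-72),(1,[0],-72),(2,[1],-72)]),
  ((1,4,5), [(0,[],-53),(2,[0,1],-103)]),
  ((1,4,5), [(0,[],-52),(2,[0],-77)]),
  ((1,5,1), [(0,[],-71),(1,[0],-71)]),
  ((1,5,1), [(0,[],-76),(1,[0],-51)]),
  ((1,5,4), [(1,[],-39),(1,[0],-89),(2,[],-64)]),
  ((1,5,5), [(0,[],-52),(1,[],-77)]),
  ((1,5,5), [(0,[],-71),(1,[0],-71)]),
  ((1,5,5), [(0,[],-32),(1,[],-82)]),
  ((1,5,5), [(0,[],-58),(1,[],-58)]),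
  ((1,5,5), [(0,[],-76),(1,[],-51),(1,[0],-76)]),
  ((2,1,1), [(0,[1],-89),(1,[],-64),(2,[0,1],-89)]),
  ((3,1,1), [(0,[1],-84),(1,[],-59),(1,[0],-84)]),
  ((3,1,1), [(0,[],-70),(1,[0],-95),(2,[0,1],-95)]),
  ((3,1,3), [(0,[1],-83),(2,[],-58),(2,[0],-108)]),
  ((3,3,1), [(1,[0],-88),(2,[],-38)]),
  ((3,5,1), [(1,[],-51),(1,[0],-101),(2,[0,1],-101)]),
  ((4,1,1), [(0,[1],-69),(2,[0,1],-94)]),
  ((4,1,1), [(0,[],-57),(1,[],-82),(2,[0,1],-107)]),
  ((4,1,1), [(0,[],-52),(1,[],-77)]),
  ((4,1,1), [(0,[],-58),(2,[0,1],-83)]),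
  ((4,1,3), [(2,[],-45),(2,[0,1],-120)]),
  ((4,1,5), [(0,[],-52),(1,[],-77)]),
  ((4,1,5), [(0,[],-57),(2,[0,1],-107)]),
  ((4,4,4), [(1,[],-64),(2,[0,1],-114)]),
  ((4,5,1), [(0,[1],-69),(2,[0,1],-94)]),
  ((4,5,1), [(2,[],-58),(2,[0,1],-108)]),
  ((4,5,1), [(0,[],-58),(1,[],-58)]),
  ((4,5,5), [(0,[],-52),(1,[],-77)]),
  ((4,5,5), [(0,[],-58),(0,[1],-83)]),
  ((5,1,1), [(0,[],-58),(2,[0],-58)]),
  ((5,1,5), [(0,[],-51),(1,[0],-76)]),
  ((5,1,5), [(0,[1],-88),(1,[0],-88),(2,[],-38)]),
  ((5,1,5), [(0,[],-32),(2,[],-82)]),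
  ((5,1,5), [(0,[],-58),(2,[],-58),(2,[0],-83)]),
  ((5,1,5), [(1,[],-52),(1,[0],-77)]),
  ((5,1,5), [(0,[1],-65),(2,[],-65),(2,[0,1],-115)]),
  ((5,1,5), [(2,[0],-59),(2,[0,1],-109)]),
  ((5,1,5), [(0,[],-52),(2,[],-77)]),
  ((5,3,1), [(1,[0],-88),(2,[],-38),(2,[0,1],-138)]),
  ((5,3,5), [(2,[],-58),(2,[0],-83)]),
  ((5,4,5), [(0,[],-57),(2,[],-57)]),
  ((5,5,1), [(0,[1],-56)]),
  ((5,5,1), [(0,[1],-57),(2,[0],-82)]),
  ((5,5,1), [(0,[1],-69),(1,[0],-94),(2,[0,1],-94)]),
  ((5,5,1), [(0,[1],-84),(1,[0],-84),(2,[],-34)]),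
  ((5,5,1), [(0,[],-57),(0,[1],-82),(2,[],-57)]),
  ((5,5,1), [(0,[],-51),(1,[0],-76)]),
  ((5,5,1), [(2,[],-65),(2,[0,1],-90)]),
  ((5,5,1), [(0,[],-52),(0,[1],-102),(2,[],-77)]),
  ((5,5,1), [(0,[],-52),(1,[0],-77),(2,[0],-77)]),
  ((5,5,3), [(2,[1],-65),(2,[0,1],-115)]),
  ((5,5,3), [(0,[1],-83),(2,[],-58),(2,[0],-83)]),
  ((5,5,4), [(2,[],-58),(2,[0,1],-108)]),
  ((5,5,4), [(0,[],-52),(1,[],-77),(2,[0],-77)]),
  ((5,5,5), [(0,[1],-56)]),
  ((5,5,5), [(0,[],-44),(1,[],-69)]),
  ((5,5,5), [(1,[],-52),(1,[0],-77)]),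
  ((5,5,5), [(0,[],-51),(1,[0],-76)])]"

lemma states_closed: "list_all (step_closed states) states"
  by code_simp

text \<open>A single vertex has excess \<open>25 - 19 * 3 = - 32\<close> at \<open>i = 3\<close>.\<close>

lemma states_start:
  "list_all (\<lambda>(r0, r1, r2). if r0 \<and> r1 \<and> r2 then True else covered_in states
       (if r0 then 1 else 5, if r1 then 1 else 5, if r2 then 1 else 5)
       [(0, [1, 2], - 32), (1, [0, 2], - 32), (2, [0, 1], - 32)]) all_reds"
  by code_simp

text \<open>Supplies the additive constant 100 in the final bound on the path length.\<close>

lemma states_weight: "list_all (\<lambda>(t, cs). list_ex (\<lambda>(e, F, w). - 100 \<le> w) cs) states"
  by code_simp

lemma covered_in_iff:
  "covered_in S t cs \<longleftrightarrow> (\<exists>(t', cs') \<in> set S. weaker_dists t t' \<and> covers cs cs')"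
  by (force simp: covered_in_def list_ex_iff)

lemma all_reds_UNIV: "r \<in> set all_reds"
  by (cases r) (auto simp: all_reds_def)

section \<open>Soundness\<close>

locale short_cycle_free =
  fixes N :: nat and R :: "nat set set"
  assumes no_short_cycle: "\<And>k. 3 \<le> k \<Longrightarrow> k \<le> 6 \<Longrightarrow> \<not> has_cycle_len R k"
begin

section \<open>Colours and red walks\<close>

definition red :: "nat \<Rightarrow> nat \<Rightarrow> bool" where "red u v \<longleftrightarrow> {u, v} \<in> R"

definition blue :: "nat \<Rightarrow> nat \<Rightarrow> bool" where "blue u v \<longleftrightarrow> {u, v} \<in> path_power3 N - R"

lemma red_sym: "red u v \<longleftrightarrow> red v u"
  by (simp add: red_def insert_commute)

lemma blueI:
  assumes "\<not> red u v" "1 \<le> u" "u < v" "v \<le> N" "v \<le> u + 3"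
  shows "blue u v" "blue v u"
proof -
  have "{u, v} \<in> path_power3 N"
    unfolding path_power3_def using assms(2-5) by (intro CollectI exI[of _ u] exI[of _ v]) auto
  then show "blue u v" "blue v u"
    using assms(1) unfolding blue_def red_def by (auto simp: insert_commute)
qed

text \<open>Walks instead of paths, so that concatenation needs no disjointness. The length counts
  edges, hence \<open>Suc d\<close> vertices; confinement to \<open>{..i}\<close> keeps
  \<open>Suc i\<close> off the walk.\<close>

definition red_walk :: "nat \<Rightarrow> nat \<Rightarrow> nat \<Rightarrow> nat \<Rightarrow> bool" where
  "red_walk i a b d \<longleftrightarrow>
     (\<exists>p. p \<noteq> [] \<and> hd p = a \<and> last p = b \<and> successively red p \<and> set p \<subseteq> {..i} \<and> length p \<le> Suc d)"

lemma red_walk_mono: "red_walk i a b d \<Longrightarrow> i \<le> i' \<Longrightarrow> d \<le> d' \<Longrightarrow> red_walk i' a b d'"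
  unfolding red_walk_def by (elim exE, rule exI) auto

lemma red_walk_edge: "red a b \<Longrightarrow> a \<le> i \<Longrightarrow> b \<le> i \<Longrightarrow> red_walk i a b 1"
  unfolding red_walk_def by (rule exI[of _ "[a, b]"]) auto

lemma red_walk_sym: "red_walk i a b d \<Longrightarrow> red_walk i b a d"
proof -
  assume "red_walk i a b d"
  then obtain p where p: "p \<noteq> []" "hd p = a" "last p = b" "successively red p"
      "set p \<subseteq> {..i}" "length p \<le> Suc d"
    unfolding red_walk_def by blast
  have "successively red (rev p)"
    using p(4) by (simp add: successively_rev red_sym)
  then show ?thesis
    using p unfolding red_walk_def by (intro exI[of _ "rev p"]) (auto simp: hd_rev last_rev)
qed

lemma red_walk_trans:
  assumes "red_walk i a b d" "red_walk i b c e"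
  shows "red_walk i a c (d + e)"
proof -
  obtain p where p: "p \<noteq> []" "hd p = a" "last p = b" "successively red p"
      "set p \<subseteq> {..i}" "length p \<le> Suc d"
    using assms(1) unfolding red_walk_def by blast
  obtain q where q: "q \<noteq> []" "hd q = b" "last q = c" "successively red q"
      "set q \<subseteq> {..i}" "length q \<le> Suc e"
    using assms(2) unfolding red_walk_def by blast
  obtain q' where q': "q = b # q'"
    using q(1,2) by (cases q) auto
  have "successively red (p @ q')" "last (p @ q') = c"
    using p q q' by (auto simp: successively_append_iff successively_Cons)
  then show ?thesis
    using p q q' unfolding red_walk_def by (intro exI[of _ "p @ q'"]) auto
qed

text \<open>A walk of least length repeats no vertex, as the part between two occurrences could be
  cut out.\<close>

lemma red_walk_distinct:
  assumes "red_walk i a b d"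
  shows "\<exists>p. p \<noteq> [] \<and> hd p = a \<and> last p = b \<and> successively red p \<and> set p \<subseteq> {..i}
             \<and> length p \<le> Suc d \<and> distinct p"
proof -
  define W where "W p \<longleftrightarrow> p \<noteq> [] \<and> hd p = a \<and> last p = b \<and> successively red p
    \<and> set p \<subseteq> {..i} \<and> length p \<le> Suc d" for p
  obtain p0 where "W p0"
    using assms unfolding red_walk_def W_def by blast
  then obtain p where p: "W p" and min: "\<And>q. W q \<Longrightarrow> length p \<le> length q"
    using ex_has_least_nat[of W p0 length] by blast
  have "distinct p"
  proof (rule ccontr)
    assume "\<not> distinct p"
    then obtain xs y ys zs where eq: "p = xs @ [y] @ ys @ [y] @ zs"
      using not_distinct_decomp by blast
    have "W (xs @ [y] @ zs)"
      using p unfolding W_def eq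
      by (cases xs) (auto simp: successively_append_iff successively_Cons hd_append split: if_splits)
    from min[OF this] show False
      by (simp add: eq)
  qed
  then show ?thesis
    using p unfolding W_def by blast
qed

text \<open>A walk without repetition and with at most four edges has at most five vertices, all
  different from \<open>Suc i\<close>; the two red edges at \<open>Suc i\<close> close it to a red
  cycle of length at most 6.\<close>

lemma red_walk_no_apex:
  assumes "red_walk i a b d" "d < 5" "a \<noteq> b" "red (Suc i) a" "red (Suc i) b"
  shows False
proof -
  obtain p where p: "p \<noteq> []" "hd p = a" "last p = b" "successively red p"
      "set p \<subseteq> {..i}" "length p \<le> Suc d" "distinct p"
    using red_walk_distinct[OF assms(1)] by blast
  have "2 \<le> length p"
    using p(1-3) assms(3) by (cases p; cases "tl p") auto
  have "has_cycle_len R (Suc (length p))"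
    unfolding has_cycle_len_def
  proof (intro conjI exI[of _ "Suc i # p"] allI impI)
    fix j assume j: "j < Suc (length p)"
    consider "j = 0" | "j = length p" | "0 < j" "j < length p"
      using j by linarith
    then show "{(Suc i # p) ! j, (Suc i # p) ! ((j + 1) mod Suc (length p))} \<in> R"
    proof cases
      case 1
      then show ?thesis
        using p(1,2) assms(4) by (simp add: red_def hd_conv_nth)
    next
      case 2
      then show ?thesis
        using p(1,3) assms(5) by (simp add: red_def last_conv_nth nth_Cons' insert_commute)
    next
      case 3
      then obtain m where "j = Suc m" by (cases j) auto
      then show ?thesis
        using p(4) 3 by (simp add: successively_conv_nth red_def)
    qed
  qed (use p \<open>2 \<le> length p\<close> in auto)
  then show False
    using no_short_cycle[of "Suc (length p)"] p(6) assms(2) \<open>2 \<le> length p\<close> by linarith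
qed

text \<open>The clause \<open>1 \<le> d\<close> makes every sum of two such values at least 2, so a
  composed route is never mistaken for a red edge.\<close>

definition dist_ok :: "nat \<Rightarrow> nat \<Rightarrow> nat \<Rightarrow> nat \<Rightarrow> bool" where
  "dist_ok i a b d \<longleftrightarrow> 1 \<le> d \<and> (d = 1 \<longleftrightarrow> red a b) \<and> (d < 5 \<longrightarrow> red_walk i a b d)"

fun dists_ok :: "nat \<Rightarrow> dists \<Rightarrow> bool" where
  "dists_ok i (x, y, z) \<longleftrightarrow>
     dist_ok i i (i - 1) x \<and> dist_ok i i (i - 2) y \<and> dist_ok i (i - 1) (i - 2) z"

lemma dist_ok_weaken: "dist_ok i a b d \<Longrightarrow> d \<le> d' \<Longrightarrow> (d = 1 \<longleftrightarrow> d' = 1) \<Longrightarrow> dist_ok i a b d'"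
  unfolding dist_ok_def by (auto intro: red_walk_mono)

lemma dists_ok_weaken: "dists_ok i t \<Longrightarrow> weaker_dists t t' \<Longrightarrow> dists_ok i t'"
  by (cases t; cases t') (auto intro: dist_ok_weaken)

definition red_pattern :: "nat \<Rightarrow> reds" where
  "red_pattern i = (red (Suc i) i, red (Suc i) (i - 1), red (Suc i) (i - 2))"

lemma not_closes_cycle:
  assumes "dists_ok i t" "3 \<le> i"
  shows "\<not> closes_cycle t (red_pattern i)"
proof (cases t)
  case (fields x y z)
  have ne: "i \<noteq> i - 1" "i \<noteq> i - 2" "i - 1 \<noteq> i - 2"
    using assms(2) by auto
  show ?thesis
    using assms(1) ne red_walk_no_apex[of i i "i - 1" x] red_walk_no_apex[of i i "i - 2" y]
      red_walk_no_apex[of i "i - 1" "i - 2" z]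
    unfolding fields red_pattern_def closes_cycle.simps dists_ok.simps dist_ok_def by blast
qed

lemma next_dists_ok:
  assumes "dists_ok i t" "3 \<le> i"
  shows "dists_ok (Suc i) (next_dists t (red_pattern i))"
proof (cases t)
  case (fields x y z)
  define r0 r1 r2 where r: "r0 = red (Suc i) i" "r1 = red (Suc i) (i - 1)" "r2 = red (Suc i) (i - 2)"
  define u where "u = min (if r0 then 1 else 5) (min (if r1 then x + 1 else 5) (if r2 then y + 1 else 5))"
  define v where "v = min (if r1 then 1 else 5) (min (if r0 then x + 1 else 5) (if r2 then z + 1 else 5))"
  have d: "dist_ok i i (i - 1) x" "dist_ok i i (i - 2) y" "dist_ok i (i - 1) (i - 2) z"
    using assms(1) fields by auto
  \<comment> \<open>A red edge from the new vertex to \<open>a\<close>, followed by an old walk from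
    \<open>a\<close> to \<open>b\<close>.\<close>
  have via: "red_walk (Suc i) (Suc i) b (e + 1)"
    if "red (Suc i) a" "a \<le> i" "e < 5" "e < 5 \<longrightarrow> red_walk i a b e" for a b e
    using red_walk_trans[OF red_walk_edge[of "Suc i" a "Suc i"] red_walk_mono[of i a b e "Suc i" e]] that
    by simp
  have rev: "e < 5 \<longrightarrow> red_walk i b a e" if "dist_ok i a b e" for a b e
    using that red_walk_sym unfolding dist_ok_def by blast
  have fwd: "e < 5 \<longrightarrow> red_walk i a b e" if "dist_ok i a b e" for a b e
    using that unfolding dist_ok_def by blast
  have edge: "red_walk (Suc i) (Suc i) a 1" if "red (Suc i) a" "a \<le> i" for a
    using red_walk_edge that by simp
  have u_cases: "u = 5 \<or> r0 \<and> u = 1 \<or> r1 \<and> u = x + 1 \<and> x < 5 \<or> r2 \<and> u = y + 1 \<and> y < 5"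
    unfolding u_def min_def by auto
  have v_cases: "v = 5 \<or> r1 \<and> v = 1 \<or> r0 \<and> v = x + 1 \<and> x < 5 \<or> r2 \<and> v = z + 1 \<and> z < 5"
    unfolding v_def min_def by auto
  have pos: "1 \<le> x" "1 \<le> y" "1 \<le> z"
    using d unfolding dist_ok_def by auto
  have u1: "u = 1 \<longleftrightarrow> r0" and v1: "v = 1 \<longleftrightarrow> r1"
    using pos unfolding u_def v_def by auto
  have "u < 5 \<longrightarrow> red_walk (Suc i) (Suc i) i u"
    using u_cases edge[of i] via[of "i - 1" x i] via[of "i - 2" y i] rev[OF d(1)] rev[OF d(2)]
    unfolding r by auto
  then have u_ok: "dist_ok (Suc i) (Suc i) i u"
    using u1 u_cases pos unfolding dist_ok_def r by auto
  have "v < 5 \<longrightarrow> red_walk (Suc i) (Suc i) (i - 1) v"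
    using v_cases edge[of "i - 1"] via[of i x "i - 1"] via[of "i - 2" z "i - 1"] fwd[OF d(1)] rev[OF d(3)]
    unfolding r by auto
  then have v_ok: "dist_ok (Suc i) (Suc i) (i - 1) v"
    using v1 v_cases pos unfolding dist_ok_def r by auto
  \<comment> \<open>A detour through the new vertex has length at least 2, so the value 1 still
    comes only from a red edge.\<close>
  have w_ok: "dist_ok (Suc i) i (i - 1) (min x (u + v))"
  proof -
    have "red_walk (Suc i) i (i - 1) (u + v)" if "u + v < 5"
    proof (rule red_walk_trans)
      show "red_walk (Suc i) i (Suc i) u"
        using that u_ok unfolding dist_ok_def by (simp add: red_walk_sym)
      show "red_walk (Suc i) (Suc i) (i - 1) v"
        using that v_ok unfolding dist_ok_def by simp
    qed
    moreover have "dist_ok (Suc i) i (i - 1) x"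
      using d(1) red_walk_mono[of i i "i - 1" x "Suc i" x] unfolding dist_ok_def by simp
    moreover have "1 \<le> u" "1 \<le> v"
      using u_ok v_ok unfolding dist_ok_def by simp_all
    ultimately show ?thesis
      unfolding dist_ok_def by (cases "x \<le> u + v") (simp_all add: min_def)
  qed
  have "next_dists t (red_pattern i) = (u, v, min x (u + v))"
    unfolding fields next_dists_def red_pattern_def u_def v_def r Let_def prod.case by (rule refl)
  then show ?thesis
    using u_ok v_ok w_ok by (simp only: dists_ok.simps diff_Suc_1 numeral_2_eq_2 diff_Suc_Suc) simp
qed

section \<open>Blue paths and their extensions\<close>

lemma blue_pair_sound:
  assumes "dists_ok i t" "3 \<le> i" "Suc i \<le> N" "blue_pair t (red_pattern i) a b"
  shows "blue (Suc i - a) (Suc i - b)"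
proof (cases t)
  case (fields x y z)
  have p: "x \<noteq> 1 \<longrightarrow> \<not> red (i - 1) i" "y \<noteq> 1 \<longrightarrow> \<not> red (i - 2) i"
    "z \<noteq> 1 \<longrightarrow> \<not> red (i - 2) (i - 1)"
    using assms(1) red_sym unfolding fields dists_ok.simps dist_ok_def by metis+
  have q: "Suc i - 1 = i" "Suc i - 2 = i - 1" "Suc i - 3 = i - 2"
    using assms(2) by auto
  have r: "\<not> red (Suc i) v \<Longrightarrow> \<not> red v (Suc i)" for v
    using red_sym by blast
  have bl: "\<not> red u v \<Longrightarrow> i - 2 \<le> u \<Longrightarrow> u < v \<Longrightarrow> v \<le> Suc i \<Longrightarrow> blue u v \<and> blue v u" for u v
    using blueI[of u v] assms(2,3) by simp
  show ?thesis
    using assms(2,4) p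
      bl[OF r, of i] bl[OF r, of "i - 1"] bl[OF r, of "i - 2"] bl[of "i - 1" i] bl[of "i - 2" i] bl[of "i - 2" "i - 1"]
    unfolding fields blue_pair_def red_pattern_def prod.case
    by (simp split: if_split_asm add: q)
qed

text \<open>The end of the path is the head of the list, so an extension is a Cons. The clause
  \<open>f \<le> i\<close> excludes truncated subtraction, so different free offsets denote
  different vertices.\<close>

fun config_ok :: "nat \<Rightarrow> config \<Rightarrow> bool" where
  "config_ok i (e, F, w) \<longleftrightarrow>
     (\<exists>p. p \<noteq> [] \<and> distinct p \<and> hd p = i - e \<and> successively blue p \<and> set p \<subseteq> {..i}
        \<and> (\<forall>f \<in> set F. f \<le> i \<and> i - f \<notin> set p) \<and> 19 * int i + w \<le> 25 * int (length p))"

text \<open>The same path serves: the new vertex lies outside \<open>{..i}\<close> and is therefore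
  free, at a loss of 19 in excess.\<close>

lemma config_ok_shift: "config_ok i c \<Longrightarrow> config_ok (Suc i) (shift c)"
proof (cases c)
  case (fields e F w)
  assume "config_ok i c"
  then obtain p where p: "p \<noteq> []" "distinct p" "hd p = i - e" "successively blue p" "set p \<subseteq> {..i}"
      "\<forall>f \<in> set F. f \<le> i \<and> i - f \<notin> set p" "19 * int i + w \<le> 25 * int (length p)"
    unfolding fields by auto
  then show ?thesis
    unfolding fields shift.simps config_ok.simps by (intro exI[of _ p]) auto
qed

lemma config_ok_extend:
  assumes "config_ok i (e, F, w)" "f \<in> set F" "blue (i - e) (i - f)"
  shows "config_ok i (f, removeAll f F, w + 25)"
proof -
  obtain p where p: "p \<noteq> []" "distinct p" "hd p = i - e" "successively blue p" "set p \<subseteq> {..i}"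
      "\<forall>f \<in> set F. f \<le> i \<and> i - f \<notin> set p" "19 * int i + w \<le> 25 * int (length p)"
    using assms(1) by auto
  have "blue (i - f) (i - e)"
    using assms(3) by (simp add: blue_def insert_commute)
  moreover have "g = f" if "g \<in> set F" "i - g = i - f" for g
    using that p(6) assms(2) by (metis diff_diff_cancel)
  ultimately show ?thesis
    using p assms(2) unfolding config_ok.simps
    by (intro exI[of _ "(i - f) # p"]) (auto simp: successively_Cons)
qed

lemma config_ok_dominates: "config_ok i c \<Longrightarrow> dominates c c' \<Longrightarrow> config_ok i c'"
proof (cases c; cases c')
  fix e F w e' F' w'
  assume "config_ok i c" "dominates c c'" and c: "c = (e, F, w)" "c' = (e', F', w')"
  then have d: "e' = e" "w' \<le> w" "set F' \<subseteq> set F"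
    by (auto simp: list_all_iff)
  obtain p where p: "p \<noteq> []" "distinct p" "hd p = i - e" "successively blue p" "set p \<subseteq> {..i}"
      "\<forall>f \<in> set F. f \<le> i \<and> i - f \<notin> set p" "19 * int i + w \<le> 25 * int (length p)"
    using \<open>config_ok i c\<close> unfolding c by auto
  then show "config_ok i c'"
    using d unfolding c config_ok.simps by (intro exI[of _ p]) auto
qed

lemma config_ok_extensions:
  assumes "\<And>a b. B a b \<Longrightarrow> blue (i - a) (i - b)"
  shows "config_ok i c \<Longrightarrow> c' \<in> set (extensions n B c) \<Longrightarrow> config_ok i c'"
proof (induction n arbitrary: c)
  case (Suc n)
  obtain e F w where c: "c = (e, F, w)"
    by (cases c)
  from Suc.prems(2) consider "c' = c"
    | f where "f \<in> set F" "B e f" "c' \<in> set (extensions n B (f, removeAll f F, w + 25))"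
    unfolding c by auto
  then show ?case
  proof cases
    case 2
    then show ?thesis
      using Suc.IH config_ok_extend[of i e F w f] Suc.prems(1) assms unfolding c by blast
  qed (use Suc.prems(1) in simp)
qed simp

section \<open>Invariance of the states and the long blue path\<close>

fun state_ok :: "nat \<Rightarrow> state \<Rightarrow> bool" where
  "state_ok i (t, cs) \<longleftrightarrow> dists_ok i t \<and> (\<forall>c \<in> set cs. config_ok i c)"

lemma covered_in_sound:
  assumes "covered_in S t cs" "state_ok i (t, cs)"
  shows "\<exists>s \<in> set S. state_ok i s"
proof -
  obtain t' cs' where s: "(t', cs') \<in> set S" "weaker_dists t t'" "covers cs cs'"
    using assms(1) unfolding covered_in_iff by blast
  have "state_ok i (t', cs')"
    unfolding state_ok.simps
  proof
    show "dists_ok i t'"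
      using assms(2) s(2) dists_ok_weaken unfolding state_ok.simps by blast
    show "\<forall>c \<in> set cs'. config_ok i c"
    proof
      fix c' assume "c' \<in> set cs'"
      then obtain c where "c \<in> set cs" "dominates c c'"
        using s(3) unfolding covers_def list_all_iff list_ex_iff by blast
      then show "config_ok i c'"
        using assms(2) config_ok_dominates unfolding state_ok.simps by blast
    qed
  qed
  then show ?thesis
    using s(1) by blast
qed

text \<open>The actual colours of the three edges at \<open>Suc i\<close> give one of the patterns
  in \<open>all_reds\<close>; the absence of short red cycles excludes those satisfying
  \<open>closes_cycle\<close>.\<close>

lemma state_ok_step:
  assumes "step_closed S s" "state_ok i s" "3 \<le> i" "Suc i \<le> N"
  shows "\<exists>s' \<in> set S. state_ok (Suc i) s'"
proof (cases s)
  case (Pair t cs)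
  let ?r = "red_pattern i"
  have t: "dists_ok i t" and cs: "\<And>c. c \<in> set cs \<Longrightarrow> config_ok i c"
    using assms(2) Pair by auto
  have "covered_in S (next_dists t ?r) (successors t ?r cs)"
    using assms(1) not_closes_cycle[OF t assms(3)] all_reds_UNIV[of ?r] unfolding Pair
    by (auto simp: list_all_iff split: if_splits)
  moreover have "config_ok (Suc i) c" if c: "c \<in> set (successors t ?r cs)" for c
  proof -
    obtain c0 where "c0 \<in> set cs" "c \<in> set (extensions 3 (blue_pair t ?r) (shift c0))"
      using c unfolding successors_def set_concat set_map by blast
    then show ?thesis
      using config_ok_extensions[OF blue_pair_sound[OF t assms(3,4)]] config_ok_shift cs by blast
  qed
  ultimately show ?thesis
    using covered_in_sound next_dists_ok[OF t assms(3)] by auto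
qed

text \<open>The scan begins at 3, where the offsets 0, 1, 2 first denote three vertices of the
  graph, namely 3, 2, 1.\<close>

lemma state_ok_start: "\<exists>s \<in> set states. state_ok 3 s"
proof -
  define r0 r1 r2 where r: "r0 = red 3 2" "r1 = red 3 1" "r2 = red 2 1"
  \<comment> \<open>Otherwise 3 is an apex over the red edge between 2 and 1, which gives a red
    triangle.\<close>
  have "\<not> (r0 \<and> r1 \<and> r2)"
    using red_walk_no_apex[of 2 2 1 1] red_walk_edge[of 2 1 2] unfolding r by auto
  then have cov: "covered_in states (if r0 then 1 else 5, if r1 then 1 else 5, if r2 then 1 else 5)
       [(0, [1, 2], - 32), (1, [0, 2], - 32), (2, [0, 1], - 32)]"
    using states_start all_reds_UNIV[of "(r0, r1, r2)"] by (auto simp: list_all_iff split: if_splits)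
  have "dist_ok 3 a b (if red a b then 1 else 5)" if "a \<le> 3" "b \<le> 3" for a b
    using that red_walk_edge unfolding dist_ok_def by auto
  then have "dists_ok 3 (if r0 then 1 else 5, if r1 then 1 else 5, if r2 then 1 else 5)"
    unfolding r by simp
  moreover have "config_ok 3 (e, F, - 32)" if "e \<notin> set F" "set F \<subseteq> {..2}" "e \<le> 2" for e F
  proof -
    have "f \<le> 3 \<and> 3 - f \<noteq> 3 - e" if "f \<in> set F" for f
      using that \<open>e \<notin> set F\<close> \<open>set F \<subseteq> {..2}\<close> \<open>e \<le> 2\<close>
      by (metis atMost_iff diff_diff_cancel le_SucI numeral_3_eq_3 numeral_2_eq_2 subsetD)
    then show ?thesis
      unfolding config_ok.simps by (intro exI[of _ "[3 - e]"]) auto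
  qed
  ultimately show ?thesis
    by (intro covered_in_sound[OF cov]) (simp del: config_ok.simps)
qed

lemma state_ok_exists: "3 \<le> i \<Longrightarrow> i \<le> N \<Longrightarrow> \<exists>s \<in> set states. state_ok i s"
proof (induction i rule: dec_induct)
  case base
  show ?case by (rule state_ok_start)
next
  case (step i)
  then show ?case
    using state_ok_step states_closed unfolding list_all_iff by (meson Suc_leD)
qed

lemma long_blue_path:
  assumes "3 \<le> N" "25 * n + 100 \<le> 19 * N"
  shows "has_path (path_power3 N - R) n"
proof -
  obtain t cs where s: "(t, cs) \<in> set states" "state_ok N (t, cs)"
    using state_ok_exists[of N] assms(1) by auto
  then obtain e F w where c: "(e, F, w) \<in> set cs" "- 100 \<le> w"
    using states_weight by (force simp: list_all_iff list_ex_iff)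
  then have "config_ok N (e, F, w)"
    using s(2) by (simp del: config_ok.simps)
  then obtain p where p: "distinct p" "successively blue p" "19 * int N + w \<le> 25 * int (length p)"
    by auto
  \<comment> \<open>25 times the length is at least 19 N - 100, hence at least 25 n.\<close>
  then have "n \<le> length p"
    using assms(2) c(2) by linarith
  then show ?thesis
    using p(1,2) unfolding has_path_def
    by (intro exI[of _ "take n p"]) (auto simp: successively_conv_nth blue_def)
qed

end

lemma path_power3_arrows:
  assumes "3 \<le> N" "25 * n + 100 \<le> 19 * N"
  shows "arrows_cyc_path (path_power3 N) (cycles_le 8) n"
  unfolding arrows_cyc_path_def
proof (intro allI impI)
  fix R
  show "(\<exists>k\<in>cycles_le 8. has_cycle_len R k) \<or> has_path (path_power3 N - R) n"
  proof (cases "\<exists>k\<in>cycles_le 8. has_cycle_len R k")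
    case False
    then interpret short_cycle_free N R
      by unfold_locales (auto simp: cycles_le_def)
    show ?thesis
      using long_blue_path[OF assms] by blast
  qed blast
qed

section \<open>Size Ramsey numbers\<close>

text \<open>An edge is determined by its smaller end and its length 1, 2 or 3. The image may also
  have edges that leave \<open>{1..N}\<close>, which is harmless for an upper bound.\<close>

lemma path_power3_subset: "path_power3 N \<subseteq> (\<lambda>(i, d). {i, i + d}) ` ({1..N} \<times> {1..3})"
proof
  fix e assume "e \<in> path_power3 N"
  then obtain i j where e: "e = {i, j}" "i \<in> {1..N}" "i < j" "j - i \<le> 3"
    unfolding path_power3_def by blast
  then show "e \<in> (\<lambda>(i, d). {i, i + d}) ` ({1..N} \<times> {1..3})"
    by (intro image_eqI[of _ _ "(i, j - i)"]) auto
qed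

lemma card_path_power3: "card (path_power3 N) \<le> 3 * N"
proof -
  have "card (path_power3 N) \<le> card ((\<lambda>(i, d). {i, i + d}) ` ({1..N} \<times> {1..3::nat}))"
    by (intro card_mono path_power3_subset) auto
  also have "\<dots> \<le> card ({1..N} \<times> {1..3::nat})"
    by (intro card_image_le) auto
  finally show ?thesis
    by (simp add: card_cartesian_product)
qed

lemma simple_graph_path_power3: "simple_graph (path_power3 N)"
  unfolding simple_graph_def
proof
  show "finite (path_power3 N)"
    by (rule finite_subset[OF path_power3_subset]) auto
  show "\<forall>e \<in> path_power3 N. card e = 2"
    unfolding path_power3_def by auto
qed

lemma arrows_cyc_path_mono: "arrows_cyc_path E L n \<Longrightarrow> L \<subseteq> L' \<Longrightarrow> arrows_cyc_path E L' n"
  unfolding arrows_cyc_path_def by blast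

lemma size_ramsey_le_card:
  fixes E :: "nat set set"
  shows "simple_graph E \<Longrightarrow> arrows_cyc_path E L n \<Longrightarrow> size_ramsey_cyc_path L n \<le> card E"
  unfolding size_ramsey_cyc_path_def by (intro cInf_lower) auto

text \<open>The graph \<open>E\<close> makes the set of edge counts for \<open>L\<close> nonempty,
  as the comparison of infima requires.\<close>

lemma size_ramsey_antimono:
  fixes E :: "nat set set"
  assumes "L \<subseteq> L'" "simple_graph E" "arrows_cyc_path E L n"
  shows "size_ramsey_cyc_path L' n \<le> size_ramsey_cyc_path L n"
  unfolding size_ramsey_cyc_path_def
  using assms arrows_cyc_path_mono by (intro cInf_superset_mono) blast+

theorem theorem1p3:
  shows "(\<forall>n N::nat. 2 \<le> n \<and> real N \<ge> 25 / 19 * real n + 43 \<longrightarrow>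
            arrows_cyc_path (path_power3 N) (cycles_le 8) n)
       \<and> (\<forall>n::nat. 2 \<le> n \<longrightarrow>
            size_ramsey_cyc_path all_cycles n \<le> size_ramsey_cyc_path (cycles_le 8) n)
       \<and> (\<exists>c::real. \<forall>n::nat. 2 \<le> n \<longrightarrow>
            real (size_ramsey_cyc_path (cycles_le 8) n) \<le> 75 / 19 * real n + c)"
proof (intro conjI allI impI exI)
  have arrows: "arrows_cyc_path (path_power3 N) (cycles_le 8) n"
    if "25 / 19 * real n + 43 \<le> real N" for n N
  proof (rule path_power3_arrows)
    \<comment> \<open>The assumption multiplied by 19, with 817 = 19 * 43.\<close>
    have "real (25 * n + 817) \<le> real (19 * N)"
      using that by simp
    then show "3 \<le> N" "25 * n + 100 \<le> 19 * N"
      by linarith+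
  qed
  show "arrows_cyc_path (path_power3 N) (cycles_le 8) n"
    if "2 \<le> n \<and> 25 / 19 * real n + 43 \<le> real N" for n N
    using arrows that by blast
  \<comment> \<open>The least admissible number of vertices; rounding up costs less than 1.\<close>
  define M where "M n = nat \<lceil>25 / 19 * real n + 43\<rceil>" for n
  have M: "25 / 19 * real n + 43 \<le> real (M n)" "real (M n) \<le> 25 / 19 * real n + 44" for n
    unfolding M_def by linarith+
  show "size_ramsey_cyc_path all_cycles n \<le> size_ramsey_cyc_path (cycles_le 8) n" for n
    by (rule size_ramsey_antimono[OF _ simple_graph_path_power3 arrows[OF M(1)]])
      (auto simp: cycles_le_def all_cycles_def)
  \<comment> \<open>At most three edges per vertex, and 132 = 3 * 44.\<close>
  show "real (size_ramsey_cyc_path (cycles_le 8) n) \<le> 75 / 19 * real n + 132" for n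
    using size_ramsey_le_card[OF simple_graph_path_power3 arrows[OF M(1)], of n]
      card_path_power3[of "M n"] M(2)[of n]
    by linarith
qed

end
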